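(* Let $n>2d\ge 4$ be integers, let $K$ be a field, $S=K[x_1,\dots,x_n]$, and let $R=R_{n,d}$ be the $d$-th squarefree Veronese subalgebra of $S$. Then $\omega_{R}^{-1}$ is minimally generated as an $R$-module by the fractions $u/(x_1\cdots x_n)$, where $u$ runs over the monomials in $S$ such that either $u$ is a product of $n-d$ distinct variables, or else, up to a permutation of the entries, $\log u$ belongs to the set $P_{n,d}$. Here $P_{n,d}$ is the set of vectors of the form $$(\underbrace{c,\dots,c}_{d+1},\,b_{d+2},\dots,b_{n-d-c+1},\,\underbrace{0,\dots,0}_{d+c-1})\in\mathbb N^n$$ with $2\le c\le n-2d$, $c\ge b_{d+2}\ge\dots\ge b_{n-d-c+1}\ge 0$ and $\sum_{i=d+2}^{n-d-c+1}b_i=n-2d-c$.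
   Context: The $d$-th squarefree Veronese subalgebra $R_{n,d}$ of $S=K[x_1,\dots,x_n]$ is the $K$-subalgebra of $S$ generated by all squarefree monomials of degree $d$; it is a normal Cohen--Macaulay domain. For a monomial $u=x_1^{b_1}\cdots x_n^{b_n}$ of $S$, $\log u=(b_1,\dots,b_n)$. The canonical module $\omega_{R}$ of $R=R_{n,d}$ is identified with the ideal of $R$ generated by the monomials $x_1^{a_1}\cdots x_n^{a_n}$ satisfying: (i) $a_i\ge 1$ and $d a_i\le -1+\sum_{j=1}^n a_j$ for all $i=1,\dots,n$; (ii) $\sum_{i=1}^n a_i\equiv 0 \pmod d$; (iii) $|\{i: a_i\ge 2\}|\le d-1$. (That this ideal is isomorphic to the canonical module of $R$ is a known result of Bruns, Vasconcelos and Villarreal.) The anti-canonical ideal is $\omega_R^{-1}=\{x\in Q(R): x\,\omega_R\subseteq R\}$, where $Q(R)$ is the field of fractions of $R$. When $c=n-2d$ the block $b_{d+2},\dots,b_{n-d-c+1}$ is empty. *)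

theory Defs
  imports
    "HOL-Library.Poly_Mapping"
    "HOL-Computational_Algebra.Computational_Algebra"
    "HOL-Combinatorics.List_Permutation"
begin

text \<open>
  Polynomials over \<open>K\<close> in the variables \<open>x\<^sub>i\<close> with \<open>i\<close> a natural number: finitely supported maps
  from exponent vectors to coefficients. The ring \<open>S = K[x\<^sub>1,\<dots>,x\<^sub>n]\<close> is the subring of those
  polynomials that involve only \<open>x\<^sub>1, \<dots>, x\<^sub>n\<close>; everything below lives in \<open>S\<close> or in its field of
  fractions, regarded as a subfield of the field of fractions of the ambient ring.
\<close>

type_synonym 'k mpoly = "(nat \<Rightarrow>\<^sub>0 nat) \<Rightarrow>\<^sub>0 'k"

definition scalar :: "'k \<Rightarrow> 'k::field mpoly" where
  "scalar c = Poly_Mapping.single 0 c"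

definition monomial :: "(nat \<Rightarrow>\<^sub>0 nat) \<Rightarrow> 'k::field mpoly" where
  "monomial a = Poly_Mapping.single a 1"

definition var :: "nat \<Rightarrow> 'k::field mpoly" where
  "var i = monomial (Poly_Mapping.single i 1)"

text \<open>The exponent vectors of the monomials of \<open>S = K[x\<^sub>1,\<dots>,x\<^sub>n]\<close>.\<close>

definition exponents :: "nat \<Rightarrow> (nat \<Rightarrow>\<^sub>0 nat) set" where
  "exponents n = {a. Poly_Mapping.keys a \<subseteq> {1..n}}"

definition subalgebra :: "'k::field mpoly set \<Rightarrow> bool" where
  "subalgebra A \<longleftrightarrow> (\<forall>c. scalar c \<in> A) \<and>
     (\<forall>p\<in>A. \<forall>q\<in>A. p + q \<in> A) \<and> (\<forall>p\<in>A. \<forall>q\<in>A. p * q \<in> A)"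

definition submodule :: "'a::comm_ring_1 set \<Rightarrow> 'a set \<Rightarrow> bool" where
  "submodule R M \<longleftrightarrow> 0 \<in> M \<and>
     (\<forall>x\<in>M. \<forall>y\<in>M. x + y \<in> M) \<and> (\<forall>r\<in>R. \<forall>x\<in>M. r * x \<in> M)"

definition minimally_generates :: "'a::comm_ring_1 set \<Rightarrow> 'a set \<Rightarrow> 'a set \<Rightarrow> bool" where
  "minimally_generates R G M \<longleftrightarrow>
     submodule R hull G = M \<and> (\<forall>H. H \<subset> G \<longrightarrow> submodule R hull H \<noteq> M)"

definition squarefree_veronese :: "nat \<Rightarrow> nat \<Rightarrow> 'k::field mpoly set" where
  "squarefree_veronese n d =
     subalgebra hull {\<Prod>i\<in>I. var i | I. I \<subseteq> {1..n} \<and> card I = d}"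

text \<open>
  The field of fractions of a subring \<open>R\<close>, as a subfield of the field of fractions of the
  ambient domain.
\<close>

definition fraction_field :: "'a::idom set \<Rightarrow> 'a fract set" where
  "fraction_field R = {Fract p q | p q. p \<in> R \<and> q \<in> R \<and> q \<noteq> 0}"

text \<open>
  The monomial generators of the canonical ideal, by the description of Bruns, Vasconcelos and
  Villarreal. The first condition is stated over the integers because of the summand \<open>-1\<close>.
  The generators lie in the squarefree Veronese subalgebra, so the submodule they
  generate is an ideal of it.
\<close>

definition canonical_exponents :: "nat \<Rightarrow> nat \<Rightarrow> (nat \<Rightarrow>\<^sub>0 nat) set" where
  "canonical_exponents n d = {a \<in> exponents n.
     (\<forall>i\<in>{1..n}. Poly_Mapping.lookup a i \<ge> 1 \<and>
        int d * int (Poly_Mapping.lookup a i) \<le> -1 + (\<Sum>j=1..n. int (Poly_Mapping.lookup a j))) \<and>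
     d dvd (\<Sum>i=1..n. Poly_Mapping.lookup a i) \<and>
     card {i \<in> {1..n}. Poly_Mapping.lookup a i \<ge> 2} \<le> d - 1}"

definition canonical_ideal :: "nat \<Rightarrow> nat \<Rightarrow> 'k::field mpoly set" where
  "canonical_ideal n d =
     submodule (squarefree_veronese n d) hull (monomial ` canonical_exponents n d)"

definition anticanonical_ideal :: "nat \<Rightarrow> nat \<Rightarrow> 'k::field mpoly fract set" where
  "anticanonical_ideal n d = {x \<in> fraction_field (squarefree_veronese n d).
     \<forall>w \<in> canonical_ideal n d. x * to_fract w \<in> to_fract ` squarefree_veronese n d}"

definition log_vector :: "nat \<Rightarrow> (nat \<Rightarrow>\<^sub>0 nat) \<Rightarrow> nat list" where
  "log_vector n a = map (Poly_Mapping.lookup a) [1..<n+1]"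

text \<open>
  The list \<open>bs\<close> is the block \<open>b\<^sub>d\<^sub>+\<^sub>2, \<dots>\<close>, of length \<open>n - 2d - c\<close>; it is empty if \<open>c = n - 2d\<close>.
  The condition on \<open>c # bs\<close> is the chain \<open>c \<ge> b\<^sub>d\<^sub>+\<^sub>2 \<ge> \<dots>\<close>.
\<close>

definition P_vectors :: "nat \<Rightarrow> nat \<Rightarrow> nat list set" where
  "P_vectors n d = {replicate (d + 1) c @ bs @ replicate (d + c - 1) 0 | c bs.
     2 \<le> c \<and> c \<le> n - 2 * d \<and> length bs = n - 2 * d - c \<and>
     sorted_wrt (\<ge>) (c # bs) \<and> sum_list bs = n - 2 * d - c}"

end

theory Submission
  imports Defs
begin

text \<open>
  \<open>R\<close> is spanned by the monomials \<open>x\<^sup>a\<close> with \<open>\<bar>a\<bar> = d m\<close> and all \<open>a\<^sub>i \<le> m\<close>. Multiplying by suitable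
  generators of the canonical ideal shows that \<open>x\<^sub>1\<cdots>x\<^sub>n \<omega>\<^sub>R\<^sup>-\<^sup>1\<close> is spanned by the monomials
  \<open>x\<^sup>u\<close> with \<open>\<bar>u\<bar> = n - 2d + d s\<close> and all \<open>u\<^sub>i \<le> s\<close>, for some \<open>s\<close>. If at most \<open>d\<close> entries of such a \<open>u\<close>
  equal \<open>s\<close>, a squarefree monomial of degree \<open>d\<close> can be split off, which lowers \<open>s\<close> by one. If more
  than \<open>d\<close> entries equal \<open>s\<close>, then \<open>u\<close> is irreducible, since splitting off \<open>a\<close> with \<open>\<bar>a\<bar> = d m\<close> would need
  \<open>a\<^sub>i \<ge> m\<close> at all those entries. The irreducible \<open>u\<close> are the squarefree ones (\<open>s = 1\<close>) and the
  permutations of vectors in \<open>P\<^sub>n\<^sub>,\<^sub>d\<close> (\<open>s = c \<ge> 2\<close>).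
\<close>

subsection \<open>Monomials and submodules\<close>

definition squarefree_exponent :: "nat set \<Rightarrow> nat \<Rightarrow>\<^sub>0 nat" where
  "squarefree_exponent I = (\<Sum>i\<in>I. Poly_Mapping.single i 1)"

lemma lookup_squarefree_exponent:
  "finite I \<Longrightarrow> Poly_Mapping.lookup (squarefree_exponent I) i = (if i \<in> I then 1 else 0)"
  by (simp add: squarefree_exponent_def lookup_sum lookup_single when_def)

lemma squarefree_exponent_in_exponents: "I \<subseteq> {1..n} \<Longrightarrow> squarefree_exponent I \<in> exponents n"
  using finite_subset[of I "{1..n}"]
  by (auto simp: exponents_def in_keys_iff lookup_squarefree_exponent split: if_splits)

lemma sum_squarefree_exponent:
  assumes "I \<subseteq> {1..n}"
  shows "(\<Sum>i=1..n. Poly_Mapping.lookup (squarefree_exponent I) i) = card I"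
proof -
  have "finite I" using assms finite_subset by blast
  then have "(\<Sum>i=1..n. Poly_Mapping.lookup (squarefree_exponent I) i) = (\<Sum>i\<in>{1..n}. if i \<in> I then 1 else 0)"
    by (simp add: lookup_squarefree_exponent)
  also have "\<dots> = card ({1..n} \<inter> I)" by (simp flip: sum.inter_restrict)
  also have "{1..n} \<inter> I = I" using assms by blast
  finally show ?thesis .
qed

lemma monomial_add: "monomial (a + b) = monomial a * monomial b"
  by (simp add: monomial_def mult_single)

lemma monomial_0: "monomial 0 = 1"
  by (simp add: monomial_def)

lemma monomial_nonzero: "(monomial a :: 'k::field mpoly) \<noteq> 0"
  by (simp add: monomial_def flip: keys_eq_empty)

lemma keys_monomial: "Poly_Mapping.keys (monomial a :: 'k::field mpoly) = {a}"
  by (simp add: monomial_def)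

lemma monomial_inject: "(monomial a :: 'k::field mpoly) = monomial b \<longleftrightarrow> a = b"
  by (metis keys_monomial singleton_inject)

lemma prod_var:
  "finite I \<Longrightarrow> (\<Prod>i\<in>I. var i :: 'k::field mpoly) = monomial (squarefree_exponent I)"
  by (induction I rule: finite_induct)
     (simp_all add: squarefree_exponent_def var_def monomial_add monomial_0)

lemma mpoly_as_sum:
  "(p :: 'k::field mpoly) = (\<Sum>a\<in>Poly_Mapping.keys p. scalar (Poly_Mapping.lookup p a) * monomial a)"
  by (rule poly_mapping_eqI)
     (simp add: scalar_def monomial_def mult_single lookup_sum lookup_single when_def
        in_keys_iff)

lemma lookup_times_monomial:
  "Poly_Mapping.lookup (p * (monomial b :: 'k::field mpoly)) (a + b) = Poly_Mapping.lookup p a"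
proof -
  have "p * monomial b = (\<Sum>c\<in>Poly_Mapping.keys p. Poly_Mapping.single (c + b) (Poly_Mapping.lookup p c))"
    by (subst mpoly_as_sum[of p])
       (simp add: sum_distrib_right scalar_def monomial_def mult_single)
  then show ?thesis
    by (simp add: lookup_sum lookup_single when_def in_keys_iff)
qed

lemma subalgebra_hull: "subalgebra (subalgebra hull A)"
  by (rule hull_in) (auto simp: subalgebra_def)

lemma submodule_hull: "submodule R (submodule R hull A)"
  by (rule hull_in) (auto simp: submodule_def)

lemma submodule_sum:
  assumes "submodule R M" "\<And>i. i \<in> I \<Longrightarrow> f i \<in> M"
  shows "sum f I \<in> M"
  using assms(2) by (induction I rule: infinite_finite_induct) (use assms(1) in \<open>auto simp: submodule_def\<close>)

lemma subalgebra_submodule: "subalgebra A \<Longrightarrow> submodule A A"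
  unfolding subalgebra_def submodule_def
  using single_zero[of 0] by (auto simp: scalar_def dest: spec[of _ 0])

lemma sum_lookup_add:
  "(\<Sum>i\<in>A. Poly_Mapping.lookup (a + b) i) =
     (\<Sum>i\<in>A. Poly_Mapping.lookup a i) + (\<Sum>i\<in>A. Poly_Mapping.lookup b i)"
  by (simp only: sum.distrib[symmetric] lookup_add[symmetric])

text \<open>Membership in \<open>anticanonical_ideal\<close> quantifies over the whole canonical
  ideal; as the w with x w in R form a submodule, testing the monomial generators is enough.\<close>

lemma submodule_colon:
  assumes "subalgebra (A :: 'k::field mpoly set)"
  shows "submodule A {w. x * to_fract w \<in> to_fract ` A}"
  unfolding submodule_def
proof (intro conjI ballI CollectI)
  have "0 \<in> A" using subalgebra_submodule[OF assms] by (simp add: submodule_def)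
  then show "x * to_fract 0 \<in> to_fract ` A" by (intro image_eqI[of _ _ 0]) simp_all
next
  fix v w assume "v \<in> {w. x * to_fract w \<in> to_fract ` A}" "w \<in> {w. x * to_fract w \<in> to_fract ` A}"
  then obtain v' w' where "v' \<in> A" "w' \<in> A" "x * to_fract v = to_fract v'" "x * to_fract w = to_fract w'"
    by blast
  then show "x * to_fract (v + w) \<in> to_fract ` A"
    using assms by (intro image_eqI[of _ _ "v' + w'"]) (simp_all add: subalgebra_def distrib_left)
next
  fix r w assume r: "r \<in> A" and "w \<in> {w. x * to_fract w \<in> to_fract ` A}"
  then obtain w' where "w' \<in> A" "x * to_fract w = to_fract w'" by blast
  then show "x * to_fract (r * w) \<in> to_fract ` A"
    using assms r by (intro image_eqI[of _ _ "r * w'"]) (simp_all add: subalgebra_def mult.left_commute)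
qed

text \<open>Division is done term by term, each exponent b of f becoming (b + \<alpha>) - \<beta>.
  This turns facts about exponents into identities between fractions.\<close>

lemma divide_monomials:
  fixes f :: "'k::field mpoly"
  assumes "\<And>b. b \<in> Poly_Mapping.keys f \<Longrightarrow> \<exists>u\<in>U. b + \<alpha> = u + \<beta>"
  obtains p where "Poly_Mapping.keys p \<subseteq> U" "f * monomial \<alpha> = p * monomial \<beta>"
proof -
  obtain g where g: "\<And>b. b \<in> Poly_Mapping.keys f \<Longrightarrow> g b \<in> U \<and> b + \<alpha> = g b + \<beta>"
    using assms by metis
  define p where "p = (\<Sum>b\<in>Poly_Mapping.keys f. Poly_Mapping.single (g b) (Poly_Mapping.lookup f b))"
  have "f * monomial \<alpha> = (\<Sum>b\<in>Poly_Mapping.keys f. Poly_Mapping.single (b + \<alpha>) (Poly_Mapping.lookup f b))"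
    by (subst mpoly_as_sum[of f])
       (simp add: sum_distrib_right scalar_def monomial_def mult_single)
  also have "\<dots> = p * monomial \<beta>"
    using g by (simp add: p_def sum_distrib_right monomial_def mult_single cong: sum.cong)
  finally have "f * monomial \<alpha> = p * monomial \<beta>" .
  moreover have "Poly_Mapping.keys p \<subseteq> U"
    unfolding p_def by (rule order.trans[OF keys_sum]) (use g in auto)
  ultimately show thesis using that by blast
qed

subsection \<open>Exponents of the Veronese algebra\<close>

text \<open>For \<open>r = 0\<close> the layers consist of the exponents occurring in \<open>R\<close>; for \<open>r = n - 2d\<close> of those
  occurring in \<open>x\<^sub>1\<cdots>x\<^sub>n \<omega>\<^sub>R\<^sup>-\<^sup>1\<close>.\<close>

definition layer :: "nat \<Rightarrow> nat \<Rightarrow> nat \<Rightarrow> nat \<Rightarrow> (nat \<Rightarrow>\<^sub>0 nat) set" where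
  "layer n d r s = {a \<in> exponents n. (\<Sum>i=1..n. Poly_Mapping.lookup a i) = r + d * s \<and>
     (\<forall>i\<in>{1..n}. Poly_Mapping.lookup a i \<le> s)}"

lemma layer_add:
  assumes "a \<in> layer n d r s" "b \<in> layer n d r' t"
  shows "a + b \<in> layer n d (r + r') (s + t)"
proof -
  have "a + b \<in> exponents n"
    using assms keys_add[of a b] by (auto simp: layer_def exponents_def)
  then show ?thesis
    using assms unfolding layer_def by (simp add: lookup_add sum.distrib distrib_left add_mono)
qed

lemma squarefree_exponent_layer:
  assumes "I \<subseteq> {1..n}" "card I = d"
  shows "squarefree_exponent I \<in> layer n d 0 1"
  using assms finite_subset[OF assms(1)] sum_squarefree_exponent[OF assms(1)]
  by (auto simp: layer_def squarefree_exponent_in_exponents lookup_squarefree_exponent)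

lemma layer_0:

  assumes "a \<in> layer n d r 0"
  shows "a = 0" "r = 0"
proof -
  have z: "Poly_Mapping.lookup a i = 0" for i
    using assms by (cases "i \<in> {1..n}") (auto simp: layer_def exponents_def in_keys_iff)
  then show "a = 0" by (intro poly_mapping_eqI) simp
  show "r = 0" using assms by (simp add: layer_def z)
qed

text \<open>I has to contain every position of the maximum, so that the bound drops to s, and has to
  stay inside the support, so that subtraction is possible. The support has at least d elements: the
  degree is at least d (s + 1) and no entry exceeds s + 1.\<close>

lemma layer_peel:
  assumes a: "a \<in> layer n d r (Suc s)"
    and le: "card {i \<in> {1..n}. Poly_Mapping.lookup a i = Suc s} \<le> d"
  obtains I u where "I \<subseteq> {1..n}" "card I = d" "u \<in> layer n d r s" "a = u + squarefree_exponent I"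
proof -
  let ?l = "Poly_Mapping.lookup a"
  let ?Y = "{i \<in> {1..n}. 1 \<le> ?l i}"
  have sum: "(\<Sum>i=1..n. ?l i) = r + d * Suc s" and bd: "\<And>i. i \<in> {1..n} \<Longrightarrow> ?l i \<le> Suc s"
    and ex: "a \<in> exponents n"
    using a by (auto simp: layer_def)
  have "(\<Sum>i=1..n. ?l i) = (\<Sum>i\<in>?Y. ?l i)"
    by (rule sum.mono_neutral_right) auto
  also have "\<dots> \<le> card ?Y * Suc s"
    using bd sum_bounded_above[of ?Y ?l "Suc s"] by simp
  finally have "d * Suc s \<le> card ?Y * Suc s" using sum by linarith
  then have "d \<le> card ?Y" by (metis mult_le_cancel2 zero_less_Suc)
  moreover have "{i \<in> {1..n}. ?l i = Suc s} \<subseteq> ?Y" "finite ?Y" by auto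
  ultimately obtain I
    where I: "{i \<in> {1..n}. ?l i = Suc s} \<subseteq> I" "I \<subseteq> ?Y" "card I = d"
    using exists_subset_between[OF le] by blast
  have I': "I \<subseteq> {1..n}" using I by blast
  then have fin: "finite I" using finite_subset by blast
  \<comment> \<open>Truncated subtraction is exact here, as I lies in the support of a.\<close>
  define u where "u = a - squarefree_exponent I"
  have lu: "Poly_Mapping.lookup u i = ?l i - (if i \<in> I then 1 else 0)" for i
    by (simp add: u_def lookup_minus lookup_squarefree_exponent[OF fin])
  have au: "a = u + squarefree_exponent I"
    using I by (intro poly_mapping_eqI) (auto simp: lookup_add lu lookup_squarefree_exponent[OF fin])
  have "(\<Sum>i=1..n. ?l i) = (\<Sum>i=1..n. Poly_Mapping.lookup u i) + d"
    by (subst au) (simp only: sum_lookup_add sum_squarefree_exponent[OF I'] I(3))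
  then have su: "(\<Sum>i=1..n. Poly_Mapping.lookup u i) = r + d * s" using sum by simp
  have "Poly_Mapping.lookup u i \<le> s" if "i \<in> {1..n}" for i
    using bd[OF that] I(1) that by (cases "?l i = Suc s") (auto simp: lu)
  moreover have "u \<in> exponents n"
    using ex by (auto simp: exponents_def in_keys_iff lu)
  ultimately have "u \<in> layer n d r s" using su by (simp add: layer_def)
  then show thesis using that I' I(3) au by blast
qed

text \<open>For r = 0 and s > 0 the degree d s leaves room for at most d entries equal to s, so
  \<open>layer_peel\<close> applies at every stage and splits a into s indicator vectors of
  d-element sets.\<close>

lemma monomial_in_veronese:
  "a \<in> layer n d 0 s \<Longrightarrow> (monomial a :: 'k::field mpoly) \<in> squarefree_veronese n d"
proof (induction s arbitrary: a)
  case 0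
  then have "monomial a = (scalar 1 :: 'k mpoly)"
    using layer_0(1)[OF 0] by (simp add: scalar_def monomial_def)
  moreover have "scalar 1 \<in> (squarefree_veronese n d :: 'k mpoly set)"
    using subalgebra_hull unfolding squarefree_veronese_def subalgebra_def by blast
  ultimately show ?case by simp
next
  case (Suc s)
  let ?l = "Poly_Mapping.lookup a"
  let ?Z = "{i \<in> {1..n}. ?l i = Suc s}"
  have "card ?Z * Suc s = (\<Sum>i\<in>?Z. ?l i)" by simp
  also have "\<dots> \<le> (\<Sum>i=1..n. ?l i)" by (rule sum_mono2) auto
  also have "\<dots> = d * Suc s" using Suc.prems by (simp add: layer_def)
  finally have "card ?Z \<le> d" by (metis mult_le_cancel2 zero_less_Suc)
  with Suc.prems obtain I u where I: "I \<subseteq> {1..n}" "card I = d" "u \<in> layer n d 0 s" "a = u + squarefree_exponent I"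
    by (rule layer_peel)
  have "(\<Prod>i\<in>I. var i :: 'k mpoly) \<in> squarefree_veronese n d"
    unfolding squarefree_veronese_def using I by (intro hull_inc) auto
  then have "monomial (squarefree_exponent I) \<in> (squarefree_veronese n d :: 'k mpoly set)"
    using I(1) by (metis prod_var finite_subset finite_atLeastAtMost)
  moreover have "monomial u \<in> (squarefree_veronese n d :: 'k mpoly set)" using I(3) by (rule Suc.IH)
  ultimately have "monomial u * monomial (squarefree_exponent I) \<in> (squarefree_veronese n d :: 'k mpoly set)"
    using subalgebra_hull unfolding squarefree_veronese_def subalgebra_def by blast
  then show ?case by (simp add: I(4) monomial_add)
qed

text \<open>One inclusion rests on \<open>layer_add\<close>, the other on
  \<open>monomial_in_veronese\<close>. From here on, membership in R is a condition on
  supports.\<close>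

lemma squarefree_veronese_eq:
  "(squarefree_veronese n d :: 'k::field mpoly set) =
     {p. Poly_Mapping.keys p \<subseteq> (\<Union>s. layer n d 0 s)}" (is "?R = ?V")
proof
  have z: "0 \<in> layer n d 0 0" by (simp add: layer_def exponents_def)
  have "subalgebra ?V"
    unfolding subalgebra_def
  proof (intro conjI allI ballI)
    fix c :: 'k show "scalar c \<in> ?V" using z by (auto simp: scalar_def split: if_splits)
  next
    fix p q :: "'k mpoly" assume pq: "p \<in> ?V" "q \<in> ?V"
    show "p + q \<in> ?V" using pq keys_add[of p q] by blast
    show "p * q \<in> ?V"
    proof
      show "Poly_Mapping.keys (p * q) \<subseteq> (\<Union>s. layer n d 0 s)"
      proof
        fix c assume "c \<in> Poly_Mapping.keys (p * q)"
        then obtain a b where c: "c = a + b" and "a \<in> Poly_Mapping.keys p" "b \<in> Poly_Mapping.keys q"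
          using keys_mult[of p q] by blast
        then obtain s t where "a \<in> layer n d 0 s" "b \<in> layer n d 0 t" using pq by blast
        then show "c \<in> (\<Union>s. layer n d 0 s)" unfolding c using layer_add by fastforce
      qed
    qed
  qed
  moreover have "{\<Prod>i\<in>I. var i | I. I \<subseteq> {1..n} \<and> card I = d} \<subseteq> ?V"
  proof
    fix p :: "'k mpoly" assume "p \<in> {\<Prod>i\<in>I. var i | I. I \<subseteq> {1..n} \<and> card I = d}"
    then obtain I where I: "I \<subseteq> {1..n}" "card I = d" and p: "p = (\<Prod>i\<in>I. var i)" by blast
    have "p = monomial (squarefree_exponent I)"
      using p I(1) prod_var[of I] finite_subset[of I "{1..n}"] by simp
    then show "p \<in> ?V"
      using squarefree_exponent_layer[OF I] by (auto simp: keys_monomial)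
  qed
  ultimately show "?R \<subseteq> ?V" unfolding squarefree_veronese_def by (intro hull_minimal)
next
  show "?V \<subseteq> ?R"
  proof
    fix p :: "'k mpoly" assume p: "p \<in> ?V"
    have R: "subalgebra ?R" unfolding squarefree_veronese_def by (rule subalgebra_hull)
    have "(\<Sum>a\<in>Poly_Mapping.keys p. scalar (Poly_Mapping.lookup p a) * monomial a) \<in> ?R"
    proof (rule submodule_sum[OF subalgebra_submodule[OF R]])
      fix a assume "a \<in> Poly_Mapping.keys p"
      then have "monomial a \<in> ?R" using p monomial_in_veronese by blast
      then show "scalar (Poly_Mapping.lookup p a) * monomial a \<in> ?R"
        using R unfolding subalgebra_def by blast
    qed
    then show "p \<in> ?R" using mpoly_as_sum[of p] by simp
  qed
qed

subsection \<open>The anti-canonical ideal\<close>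

text \<open>Writing the degree as d s, the inequality d a_i < d s bounds the entries. Thus the
  generators of the canonical ideal are elements of R.\<close>

lemma canonical_exponents_layer:
  assumes "a \<in> canonical_exponents n d" "0 < d"
  shows "\<exists>s. a \<in> layer n d 0 s"
proof -
  obtain s where s: "(\<Sum>i=1..n. Poly_Mapping.lookup a i) = d * s"
    using assms by (auto simp: canonical_exponents_def elim: dvdE)
  have "Poly_Mapping.lookup a i \<le> s" if "i \<in> {1..n}" for i
  proof -
    have "int d * int (Poly_Mapping.lookup a i) \<le> -1 + (\<Sum>j=1..n. int (Poly_Mapping.lookup a j))"
      using assms that by (auto simp: canonical_exponents_def)
    also have "(\<Sum>j=1..n. int (Poly_Mapping.lookup a j)) = int (d * s)" 
      using s by (metis of_nat_sum)
    finally have "int (d * Poly_Mapping.lookup a i) < int (d * s)" by simp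
    then have "d * Poly_Mapping.lookup a i < d * s" by linarith
    then show ?thesis by simp
  qed
  then show ?thesis using s assms by (auto simp: layer_def canonical_exponents_def)
qed

text \<open>Entries outside \<open>J\<close> have the minimal value \<open>1\<close>, and those inside \<open>J\<close> (if \<open>\<bar>J\<bar> = d - 1\<close>) have the
  minimal slack \<open>\<bar>a\<bar> - d a\<^sub>i = d\<close>. These exponents alone cut out the anti-canonical ideal.\<close>

definition extremal_exponent :: "nat \<Rightarrow> nat \<Rightarrow> nat set \<Rightarrow> nat \<Rightarrow>\<^sub>0 nat" where
  "extremal_exponent n d J =
     squarefree_exponent {1..n} + (\<Sum>i\<in>J. Poly_Mapping.single i (n - 2 * d))"

lemma lookup_extremal_exponent:
  assumes "J \<subseteq> {1..n}" "i \<in> {1..n}"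
  shows "Poly_Mapping.lookup (extremal_exponent n d J) i = 1 + (if i \<in> J then n - 2 * d else 0)"
  using assms finite_subset[OF assms(1)]
  by (simp add: extremal_exponent_def lookup_add lookup_squarefree_exponent lookup_sum lookup_single when_def)

lemma sum_extremal_exponent:
  assumes "J \<subseteq> {1..n}"
  shows "(\<Sum>i=1..n. Poly_Mapping.lookup (extremal_exponent n d J) i) = n + card J * (n - 2 * d)"
proof -
  have "(\<Sum>i=1..n. Poly_Mapping.lookup (extremal_exponent n d J) i)
      = (\<Sum>i=1..n. 1 + (if i \<in> J then n - 2 * d else 0))"
    using assms by (intro sum.cong) (auto simp: lookup_extremal_exponent)
  also have "\<dots> = n + (\<Sum>i\<in>{1..n} \<inter> J. n - 2 * d)"
    unfolding sum.distrib by (simp only: sum.inter_restrict[OF finite_atLeastAtMost]) simp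
  also have "{1..n} \<inter> J = J" using assms by blast
  finally show ?thesis by simp
qed

lemma extremal_exponent_canonical:
  assumes J: "J \<subseteq> {1..n}" "card J = d - 1" and "2 * d < n" "2 \<le> d"
  shows "extremal_exponent n d J \<in> canonical_exponents n d"
    and "(\<Sum>i=1..n. Poly_Mapping.lookup (extremal_exponent n d J) i) = d * (n - 2 * d + 2)"
proof -
  let ?a = "extremal_exponent n d J"
  have fin: "finite J" using J finite_subset by blast
  \<comment> \<open>These parameters remove the truncated subtractions: n + (d - 1) k = d (k + 2)
    becomes a polynomial identity.\<close>
  obtain e k where d: "d = Suc e" and n: "n = 2 * d + k"
    using assms by (metis Suc_le_D less_eqE less_imp_le_nat numeral_2_eq_2)
  show sum: "(\<Sum>i=1..n. Poly_Mapping.lookup ?a i) = d * (n - 2 * d + 2)"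
    unfolding sum_extremal_exponent[OF J(1)] using J(2) by (simp add: d n algebra_simps)
  have isum: "(\<Sum>i=1..n. int (Poly_Mapping.lookup ?a i)) = int d * (int (n - 2 * d) + 2)"
    using arg_cong[OF sum, of int] by (simp add: distrib_left)
  have ex: "?a \<in> exponents n"
    using J(1) fin by (auto simp: exponents_def in_keys_iff extremal_exponent_def lookup_add
        lookup_squarefree_exponent lookup_sum lookup_single when_def split: if_splits)
  have "{i \<in> {1..n}. 2 \<le> Poly_Mapping.lookup ?a i} \<subseteq> J"
    using J(1) by (auto simp: lookup_extremal_exponent split: if_splits)
  then have "card {i \<in> {1..n}. 2 \<le> Poly_Mapping.lookup ?a i} \<le> d - 1"
    using card_mono[OF fin] J(2) by metis
  moreover have "int d * int (Poly_Mapping.lookup ?a i) \<le> -1 + int d * (int (n - 2 * d) + 2)"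
    if "i \<in> {1..n}" for i
  proof -
    have "int d * int (Poly_Mapping.lookup ?a i) \<le> int d * (int (n - 2 * d) + 1)"
      using that J(1) by (intro mult_left_mono) (auto simp: lookup_extremal_exponent)
    also have "\<dots> \<le> -1 + int d * (int (n - 2 * d) + 2)"
      using \<open>2 \<le> d\<close> by (simp add: algebra_simps)
    finally show ?thesis .
  qed
  moreover have "1 \<le> Poly_Mapping.lookup ?a i" if "i \<in> {1..n}" for i
    using that J(1) by (simp add: lookup_extremal_exponent)
  ultimately show "?a \<in> canonical_exponents n d"
    unfolding canonical_exponents_def using ex sum isum by simp
qed


text \<open>Here b is an exponent of x x^a0 for an anti-canonical x, and the tests express that x
  multiplies each x^a into R. For u = b + (1,...,1) - a0, sets J avoiding i force u_i >= 0, and sets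
  J containing i force the upper bound on u_i.\<close>

lemma anticanonical_exponent:
  assumes n: "2 * d < n" "2 \<le> d"
    and tests: "\<And>a. a \<in> canonical_exponents n d \<Longrightarrow> \<exists>s. \<exists>b'\<in>layer n d 0 s. b + a = b' + a0"
    and ex: "b \<in> exponents n" "a0 \<in> exponents n"
  shows "\<exists>u\<in>(\<Union>s. layer n d (n - 2 * d) s). b + squarefree_exponent {1..n} = u + a0"
proof -
  let ?l = Poly_Mapping.lookup
  let ?e = "squarefree_exponent {1..n}"
  define k where "k = n - 2 * d"
  have nk: "n = 2 * d + k" using n by (simp add: k_def)
  \<comment> \<open>For i outside J the extremal exponent has entry 1, so b_i + 1 - a0_i = b'_i >=
    0.\<close>
  have le: "?l a0 i \<le> ?l b i + 1" if i: "i \<in> {1..n}" for i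
  proof -
    have "d - 1 \<le> card ({1..n} - {i})" using n i by simp
    then obtain J where J: "J \<subseteq> {1..n} - {i}" "card J = d - 1"
      by (rule obtain_subset_with_card_n)
    then have J': "J \<subseteq> {1..n}" by blast
    obtain b' where "b + extremal_exponent n d J = b' + a0"
      using tests[OF extremal_exponent_canonical(1)[OF J' J(2) n]] by blast
    then have "?l (b + extremal_exponent n d J) i = ?l (b' + a0) i" by simp
    then show ?thesis using J(1) i by (auto simp: lookup_add lookup_extremal_exponent[OF J'] split: if_splits)
  qed
  \<comment> \<open>By \<open>le\<close> the truncated subtraction is exact on {1..n}; elsewhere all
    entries vanish.\<close>
  define u where "u = b + ?e - a0"
  have lu: "?l u i = ?l b i + (if i \<in> {1..n} then 1 else 0) - ?l a0 i" for i
    by (simp add: u_def lookup_minus lookup_add lookup_squarefree_exponent)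
  have out: "?l b i = 0" "?l a0 i = 0" if "i \<notin> {1..n}" for i
    using ex that by (auto simp: exponents_def in_keys_iff)
  have eq: "b + ?e = u + a0"
  proof (rule poly_mapping_eqI)
    fix i show "?l (b + ?e) i = ?l (u + a0) i"
      using le[of i] out[of i] by (cases "i \<in> {1..n}") (auto simp: lookup_add lu lookup_squarefree_exponent)
  qed
  have uex: "u \<in> exponents n"
    unfolding exponents_def
  proof (intro CollectI subsetI)
    fix i assume "i \<in> Poly_Mapping.keys u"
    then show "i \<in> {1..n}" using out(1)[of i] by (cases "i \<in> {1..n}") (auto simp: in_keys_iff lu)
  qed
  have "(\<Sum>i=1..n. ?l (b + ?e) i) = (\<Sum>i=1..n. ?l (u + a0) i)" by (simp only: eq)
  then have su: "(\<Sum>i=1..n. ?l b i) + n = (\<Sum>i=1..n. ?l u i) + (\<Sum>i=1..n. ?l a0 i)"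
    using sum_squarefree_exponent[of "{1..n}" n] by (simp only: sum_lookup_add) simp
  \<comment> \<open>For i in J the test reads b' = u + k 1_J, whence |u| + (d - 1) k = d s' and u_i
    + k <= s'. The witness is s = s' - k.\<close>
  have bound: "\<exists>s. (\<Sum>j=1..n. ?l u j) = k + d * s \<and> ?l u i \<le> s" if i: "i \<in> {1..n}" for i
  proof -
    \<comment> \<open>A set of size d - 1 can contain i because d >= 2; J0 fills the other d - 2
      places.\<close>
    have "d - 1 - card {i} \<le> card ({1..n} - {i})" using n i by simp
    then obtain J0 where J0: "J0 \<subseteq> {1..n} - {i}" "card J0 = d - 1 - card {i}" "finite J0"
      by (rule obtain_subset_with_card_n)
    define J where "J = insert i J0"
    have iJ: "i \<notin> J0" using J0 by blast
    have J: "J \<subseteq> {1..n}" "card J = d - 1" "i \<in> J"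
      using J0(1) i n iJ J0(2,3) by (auto simp: J_def)
    let ?a = "extremal_exponent n d J"
    obtain s' b' where b': "b' \<in> layer n d 0 s'" "b + ?a = b' + a0"
      using tests[OF extremal_exponent_canonical(1)[OF J(1,2) n]] by blast
    have "?l (b + ?a) i = ?l (b' + a0) i" using b'(2) by simp
    then have "?l b i + 1 + k = ?l b' i + ?l a0 i"
      using J i by (auto simp: lookup_add lookup_extremal_exponent[OF J(1)] k_def)
    moreover have "?l b' i \<le> s'" using b'(1) i by (auto simp: layer_def)
    ultimately have *: "?l u i + k \<le> s'" using le[OF i] i by (simp add: lu)
    have "(\<Sum>i=1..n. ?l (b + ?a) i) = (\<Sum>i=1..n. ?l (b' + a0) i)" by (simp only: b'(2))
    then have "(\<Sum>i=1..n. ?l b i) + d * (k + 2) = (\<Sum>i=1..n. ?l b' i) + (\<Sum>i=1..n. ?l a0 i)"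
      by (simp only: sum_lookup_add extremal_exponent_canonical(2)[OF J(1,2) n] k_def)
    moreover have "(\<Sum>i=1..n. ?l b' i) = d * s'" using b'(1) by (simp add: layer_def)
    ultimately have "(\<Sum>i=1..n. ?l u i) + d * k = d * s' + k" 
      using su nk by (simp add: algebra_simps)
    moreover obtain s where "s' = s + k" using * by (metis add_leD2 le_Suc_ex add.commute)
    ultimately show ?thesis using * by (intro exI[of _ s]) (simp add: algebra_simps)
  qed
  \<comment> \<open>The s given by \<open>bound\<close> may depend on i, but |u| = k + d s
    determines it, so the one found at index 1 serves for all i.\<close>
  have one: "1 \<in> {1..n}" using n by auto
  obtain s where s: "(\<Sum>j=1..n. ?l u j) = k + d * s" using bound[OF one] by blast
  have "?l u i \<le> s" if i: "i \<in> {1..n}" for i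
    using bound[OF i] s n by auto
  then have "u \<in> layer n d k s" using s uex by (simp add: layer_def)
  then show ?thesis using eq by (auto simp: k_def)
qed

text \<open>If |a| = d t, then 1 <= a_i <= t - 1. Hence 0 <= u_i + a_i - 1 <= s + t - 2, while u + a
  - (1,...,1) has degree (n - 2d) + d s + d t - n = d (s + t - 2).\<close>

lemma canonical_shift:
  assumes "2 * d < n" "2 \<le> d"
    and u: "u \<in> layer n d (n - 2 * d) s" and a: "a \<in> canonical_exponents n d"
  shows "\<exists>v\<in>(\<Union>s. layer n d 0 s). u + a = v + squarefree_exponent {1..n}"
proof -
  let ?l = Poly_Mapping.lookup
  let ?e = "squarefree_exponent {1..n}"
  obtain t where t: "a \<in> layer n d 0 t" using canonical_exponents_layer[OF a] assms by auto
  then have st: "(\<Sum>i=1..n. ?l a i) = d * t" by (simp add: layer_def)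
  then have ist: "(\<Sum>i=1..n. int (?l a i)) = int (d * t)" by (metis of_nat_sum)
  have ge: "1 \<le> ?l a i" if "i \<in> {1..n}" for i using a that by (auto simp: canonical_exponents_def)
  have lt: "?l a i < t" if "i \<in> {1..n}" for i
  proof -
    have "int d * int (?l a i) \<le> -1 + (\<Sum>j=1..n. int (?l a j))"
      using a that by (auto simp: canonical_exponents_def)
    then have "int (d * ?l a i) < int (d * t)" unfolding ist by simp
    then have "d * ?l a i < d * t" by linarith
    then show ?thesis by simp
  qed
  have "1 \<in> {1..n}" using assms by auto
  then have "2 \<le> t" using ge[of 1] lt[of 1] by linarith
  then obtain t' where t': "t = t' + 2" by (metis add.commute le_Suc_ex)
  define v where "v = u + a - ?e"
  have lv: "?l v i = ?l u i + ?l a i - (if i \<in> {1..n} then 1 else 0)" for i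
    by (simp add: v_def lookup_minus lookup_add lookup_squarefree_exponent)
  have eq: "u + a = v + ?e"
  proof (rule poly_mapping_eqI)
    fix i show "?l (u + a) i = ?l (v + ?e) i"
      using ge[of i] by (auto simp: lookup_add lv lookup_squarefree_exponent)
  qed
  have "(\<Sum>i=1..n. ?l (u + a) i) = (\<Sum>i=1..n. ?l (v + ?e) i)" by (simp only: eq)
  then have "(\<Sum>i=1..n. ?l u i) + (\<Sum>i=1..n. ?l a i) = (\<Sum>i=1..n. ?l v i) + n"
    using sum_squarefree_exponent[of "{1..n}" n] by (simp only: sum_lookup_add) simp
  moreover have "(\<Sum>i=1..n. ?l u i) = n - 2 * d + d * s" using u by (simp add: layer_def)
  ultimately have "(\<Sum>i=1..n. ?l v i) = d * (s + t')"
    using st t' assms(1) by (simp add: algebra_simps)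
  moreover have "?l v i \<le> s + t'" if i: "i \<in> {1..n}" for i
  proof -
    have "?l u i \<le> s" using u i by (auto simp: layer_def)
    then show ?thesis using lt[OF i] ge[OF i] i by (simp add: lv t')
  qed
  moreover have "v \<in> exponents n"
    unfolding exponents_def
  proof safe
    fix i assume "i \<in> Poly_Mapping.keys v"
    then have "i \<in> Poly_Mapping.keys u \<or> i \<in> Poly_Mapping.keys a" by (auto simp: in_keys_iff lv)
    then show "i \<in> {1..n}" using u t by (auto simp: layer_def exponents_def)
  qed
  ultimately have "v \<in> layer n d 0 (s + t')" by (simp add: layer_def)
  then show ?thesis using eq by blast
qed

section \<open>Fractions with a fixed monomial denominator\<close>

definition fractions :: "(nat \<Rightarrow>\<^sub>0 nat) set \<Rightarrow> (nat \<Rightarrow>\<^sub>0 nat) \<Rightarrow> 'k::field mpoly fract set" where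
  "fractions U e = {to_fract p / to_fract (monomial e) | p. Poly_Mapping.keys p \<subseteq> U}"

text \<open>Multiplying by an element of R adds exponents of R to those of the numerator. Besides
  the union of all layers, U will be that union with one irreducible exponent removed.\<close>

lemma submodule_fractions:
  assumes "\<And>u a s. u \<in> U \<Longrightarrow> a \<in> layer n d 0 s \<Longrightarrow> u + a \<in> U"
  shows "submodule (to_fract ` squarefree_veronese n d) (fractions U e :: 'k::field mpoly fract set)"
  unfolding submodule_def
proof (intro conjI ballI)
  show "0 \<in> (fractions U e :: 'k mpoly fract set)"
    unfolding fractions_def by (intro CollectI exI[of _ 0]) simp
next
  fix x y :: "'k mpoly fract" assume "x \<in> fractions U e" "y \<in> fractions U e"
  then obtain p q where "x = to_fract p / to_fract (monomial e)" "Poly_Mapping.keys p \<subseteq> U"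
    "y = to_fract q / to_fract (monomial e)" "Poly_Mapping.keys q \<subseteq> U"
    by (auto simp: fractions_def)
  then show "x + y \<in> fractions U e"
    using keys_add[of p q] unfolding fractions_def
    by (intro CollectI exI[of _ "p + q"]) (auto simp: add_divide_distrib)
next
  fix r x :: "'k mpoly fract" assume "r \<in> to_fract ` squarefree_veronese n d" "x \<in> fractions U e"
  then obtain p q where pq: "x = to_fract p / to_fract (monomial e)" "Poly_Mapping.keys p \<subseteq> U"
    "r = to_fract q" "Poly_Mapping.keys q \<subseteq> (\<Union>s. layer n d 0 s)"
    by (auto simp: fractions_def squarefree_veronese_eq)
  have "Poly_Mapping.keys (p * q) \<subseteq> U"
  proof
    fix c assume "c \<in> Poly_Mapping.keys (p * q)"
    then obtain a b where "c = a + b" "a \<in> Poly_Mapping.keys p" "b \<in> Poly_Mapping.keys q"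
      using keys_mult[of p q] by blast
    then show "c \<in> U" using assms pq by blast
  qed
  then show "r * x \<in> fractions U e"
    using pq unfolding fractions_def by (intro CollectI exI[of _ "p * q"]) auto
qed

text \<open>A single canonical exponent a0 serves as denominator, x = f / x^a0. For each canonical a
  one has f x^a = g x^a0 with g in R, and comparing supports yields the tests of
  \<open>anticanonical_exponent\<close>. Conversely, \<open>canonical_shift\<close> settles the
  products with monomial generators.\<close>

lemma anticanonical_ideal_eq:
  assumes n: "2 * d < n" "2 \<le> d"
  shows "(anticanonical_ideal n d :: 'k::field mpoly fract set) =
    fractions (\<Union>s. layer n d (n - 2 * d) s) (squarefree_exponent {1..n})"
proof (intro equalityI subsetI)
  let ?R = "squarefree_veronese n d :: 'k mpoly set"
  let ?e = "squarefree_exponent {1..n}"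
  have "d - 1 \<le> card {1..n}" using n by simp
  then obtain J where J: "J \<subseteq> {1..n}" "card J = d - 1"
    by (rule obtain_subset_with_card_n)
  define a0 where "a0 = extremal_exponent n d J"
  have a0: "a0 \<in> canonical_exponents n d"
    unfolding a0_def by (rule extremal_exponent_canonical(1)[OF J n])
  have mono: "(monomial a :: 'k mpoly) \<in> canonical_ideal n d" if "a \<in> canonical_exponents n d" for a
    using that unfolding canonical_ideal_def by (intro hull_inc) auto
  {
    fix x :: "'k mpoly fract" assume x: "x \<in> anticanonical_ideal n d"
    then have xa: "x * to_fract (monomial a) \<in> to_fract ` ?R" if "a \<in> canonical_exponents n d" for a
      using mono[OF that] by (auto simp: anticanonical_ideal_def)
    then obtain f where f: "f \<in> ?R" "x * to_fract (monomial a0) = to_fract f" using a0 by blast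
    have "\<exists>u\<in>(\<Union>s. layer n d (n - 2 * d) s). b + ?e = u + a0" if b: "b \<in> Poly_Mapping.keys f" for b
    proof (rule anticanonical_exponent[OF n])
      fix a assume a: "a \<in> canonical_exponents n d"
      then obtain g where g: "g \<in> ?R" "x * to_fract (monomial a) = to_fract g" using xa by blast
      have "to_fract (f * monomial a) = to_fract (g * monomial a0)"
        by (simp flip: f(2) g(2))
      then have fg: "f * monomial a = g * monomial a0" by (simp only: to_fract_eq_iff)
      \<comment> \<open>Multiplication by a monomial shifts the support without
        cancellation.\<close>
      have "b + a \<in> Poly_Mapping.keys (f * monomial a)"
        using b by (simp add: in_keys_iff lookup_times_monomial)
      then obtain b' where "b' \<in> Poly_Mapping.keys g" "b + a = b' + a0"
        unfolding fg using keys_mult[of g "monomial a0"] by (auto simp: keys_monomial)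
      then show "\<exists>s. \<exists>b'\<in>layer n d 0 s. b + a = b' + a0"
        using g(1) unfolding squarefree_veronese_eq by blast
    next
      show "b \<in> exponents n" using b f(1) by (auto simp: squarefree_veronese_eq layer_def)
      show "a0 \<in> exponents n" using a0 by (simp add: canonical_exponents_def)
    qed
    then obtain p where p: "Poly_Mapping.keys p \<subseteq> (\<Union>s. layer n d (n - 2 * d) s)"
      "f * monomial ?e = p * monomial a0" by (rule divide_monomials)
    have "x * to_fract (monomial a0) * to_fract (monomial ?e) = to_fract p * to_fract (monomial a0)"
      unfolding f(2) using arg_cong[OF p(2), of to_fract] by simp
    then have "x = to_fract p / to_fract (monomial ?e)"
      using monomial_nonzero[where 'k='k] by (simp add: eq_divide_eq)
    then show "x \<in> fractions (\<Union>s. layer n d (n - 2 * d) s) ?e"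
      using p(1) by (auto simp: fractions_def)
  next
    fix x :: "'k mpoly fract" assume "x \<in> fractions (\<Union>s. layer n d (n - 2 * d) s) ?e"
    then obtain p where p: "Poly_Mapping.keys p \<subseteq> (\<Union>s. layer n d (n - 2 * d) s)"
      and x: "x = to_fract p / to_fract (monomial ?e)" by (auto simp: fractions_def)
    have xa: "x * to_fract (monomial a) \<in> to_fract ` ?R" if a: "a \<in> canonical_exponents n d" for a
    proof -
      have "\<exists>v\<in>(\<Union>s. layer n d 0 s). u + a = v + ?e" if u: "u \<in> Poly_Mapping.keys p" for u
      proof -
        obtain s where "u \<in> layer n d (n - 2 * d) s" using p u by blast
        then show ?thesis by (rule canonical_shift[OF n _ a])
      qed
      then obtain q where q: "Poly_Mapping.keys q \<subseteq> (\<Union>s. layer n d 0 s)"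
        "p * monomial a = q * monomial ?e" by (rule divide_monomials)
      have "x * to_fract (monomial a) = to_fract (p * monomial a) / to_fract (monomial ?e)"
        by (simp only: x to_fract_mult times_divide_eq_left)
      also have "\<dots> = to_fract q"
        unfolding q(2) to_fract_mult
        by (rule nonzero_mult_div_cancel_right) (simp only: to_fract_eq_0_iff monomial_nonzero not_False_eq_True)
      finally have "x * to_fract (monomial a) = to_fract q" .
      moreover have "q \<in> ?R" using q(1) by (simp add: squarefree_veronese_eq)
      ultimately show ?thesis by (rule image_eqI)
    qed
    have R: "subalgebra ?R" unfolding squarefree_veronese_def by (rule subalgebra_hull)
    have "canonical_ideal n d \<subseteq> {w. x * to_fract w \<in> to_fract ` ?R}"
      unfolding canonical_ideal_def using xa by (intro hull_minimal submodule_colon[OF R]) blast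
    \<comment> \<open>The monomial x_1...x_n need not lie in R, since d need not divide n; x^a0
      does, so it is taken as denominator.\<close>
    moreover have "x \<in> fraction_field ?R"
    proof -
      obtain q where q: "q \<in> ?R" "x * to_fract (monomial a0) = to_fract q" using xa[OF a0] by blast
      have "monomial a0 \<in> ?R"
        using canonical_exponents_layer[OF a0] n monomial_in_veronese by auto
      moreover have "x = Fract q (monomial a0)"
        unfolding Fract_conv_to_fract using q(2) monomial_nonzero[where 'k='k]
        by (simp add: eq_divide_eq)
      ultimately show ?thesis using q(1) monomial_nonzero[where 'k='k] unfolding fraction_field_def by blast
    qed
    ultimately show "x \<in> anticanonical_ideal n d" unfolding anticanonical_ideal_def by blast
  }
qed

subsection \<open>Irreducible exponents\<close>

text \<open>The cardinality condition negates the bound required by \<open>layer_peel\<close>. For d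
  > 0 the degree of a determines s.\<close>

definition irreducible_exponents :: "nat \<Rightarrow> nat \<Rightarrow> nat \<Rightarrow> (nat \<Rightarrow>\<^sub>0 nat) set" where
  "irreducible_exponents n d r = {a. \<exists>s. a \<in> layer n d r s \<and>
     d < card {i \<in> {1..n}. Poly_Mapping.lookup a i = s}}"

text \<open>At more than d positions u + a reaches s + t, and u_i <= s forces a_i >= t there. A
  positive t would then give |a| > d t.\<close>

lemma irreducible_not_sum:
  assumes u0: "u + a \<in> irreducible_exponents n d r" and u: "u \<in> layer n d r s" and a: "a \<in> layer n d 0 t"
    and "0 < d"
  shows "a = 0"
proof -
  let ?l = Poly_Mapping.lookup
  obtain s' where s': "u + a \<in> layer n d r s'" and c: "d < card {i \<in> {1..n}. ?l (u + a) i = s'}" (is "_ < card ?Z")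
    using u0 by (auto simp: irreducible_exponents_def)
  have "u + a \<in> layer n d (r + 0) (s + t)" using u a by (rule layer_add)
  with s' have "r + d * s' = r + d * (s + t)" by (simp add: layer_def)
  then have s'_eq: "s' = s + t" using \<open>0 < d\<close> by simp
  have "t \<le> ?l a i" if "i \<in> ?Z" for i
  proof -
    have "?l u i \<le> s" using u that by (auto simp: layer_def)
    then show ?thesis using that by (simp add: lookup_add s'_eq)
  qed
  then have "card ?Z * t \<le> (\<Sum>i\<in>?Z. ?l a i)"
    using sum_bounded_below[of ?Z t "?l a"] by simp
  also have "\<dots> \<le> (\<Sum>i=1..n. ?l a i)" by (rule sum_mono2) auto
  also have "\<dots> = d * t" using a by (simp add: layer_def)
  finally have "card ?Z * t \<le> d * t" .
  then have "t = 0" using c by (metis mult_le_cancel2 not_le neq0_conv)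
  then show ?thesis using a layer_0(1) by blast
qed

section \<open>Minimal generation by the irreducible exponents\<close>

lemma monomial_in_fractions_iff:
  "(to_fract (monomial a) / to_fract (monomial e) :: 'k::field mpoly fract) \<in> fractions U e \<longleftrightarrow> a \<in> U"
proof
  assume "(to_fract (monomial a) / to_fract (monomial e) :: 'k mpoly fract) \<in> fractions U e"
  then obtain p :: "'k mpoly" where p: "Poly_Mapping.keys p \<subseteq> U"
    "to_fract (monomial a) / to_fract (monomial e) = to_fract p / to_fract (monomial e)"
    unfolding fractions_def by blast
  then have "monomial a = p" using monomial_nonzero[of e, where 'k='k] by simp
  with p(1) show "a \<in> U" by (auto simp: keys_monomial)
next
  assume "a \<in> U"
  then show "(to_fract (monomial a) / to_fract (monomial e) :: 'k mpoly fract) \<in> fractions U e"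
    unfolding fractions_def by (intro CollectI exI[of _ "monomial a"]) (simp add: keys_monomial)
qed

text \<open>Peeling lowers s each time and has to stop at an irreducible exponent, because layer 0
  is empty for r > 0.\<close>

lemma fraction_generator_in_hull:
  assumes "0 < r" and "u \<in> layer n d r s"
  shows "to_fract (monomial u) / to_fract (monomial e) \<in>
    submodule (to_fract ` (squarefree_veronese n d :: 'k::field mpoly set)) hull
      {to_fract (monomial a) / to_fract (monomial e) | a. a \<in> irreducible_exponents n d r}"
    (is "_ \<in> submodule ?R hull ?G")
  using assms(2)
proof (induction s arbitrary: u)
  case 0
  then show ?case using layer_0(2)[OF 0] \<open>0 < r\<close> by simp
next
  case (Suc s)
  show ?case
  proof (cases "d < card {i \<in> {1..n}. Poly_Mapping.lookup u i = Suc s}")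
    case True
    then have "u \<in> irreducible_exponents n d r"
      using Suc.prems unfolding irreducible_exponents_def by blast
    then show ?thesis by (intro hull_inc) blast
  next
    case False
    then have "card {i \<in> {1..n}. Poly_Mapping.lookup u i = Suc s} \<le> d" by simp
    with Suc.prems obtain I v where I: "I \<subseteq> {1..n}" "card I = d" "v \<in> layer n d r s"
      and u: "u = v + squarefree_exponent I" by (rule layer_peel)
    have "to_fract (monomial (squarefree_exponent I)) \<in> ?R"
      using monomial_in_veronese[OF squarefree_exponent_layer[OF I(1,2)]] by (rule imageI)
    moreover have "to_fract (monomial v) / to_fract (monomial e) \<in> submodule ?R hull ?G"
      using I(3) by (rule Suc.IH)
    ultimately have "to_fract (monomial (squarefree_exponent I)) * (to_fract (monomial v) / to_fract (monomial e))
        \<in> submodule ?R hull ?G"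
      using submodule_hull[of ?R ?G] unfolding submodule_def by blast
    then show ?thesis by (simp add: u monomial_add mult.commute)
  qed
qed

lemma hull_irreducible:
  assumes "0 < r"
  shows "submodule (to_fract ` (squarefree_veronese n d :: 'k::field mpoly set)) hull
      {to_fract (monomial a) / to_fract (monomial e) | a. a \<in> irreducible_exponents n d r}
    = fractions (\<Union>s. layer n d r s) e"
    (is "submodule ?R hull ?G = ?F")
proof
  have "submodule ?R ?F"
  proof (rule submodule_fractions)
    fix u a s assume "u \<in> (\<Union>s. layer n d r s)" "a \<in> layer n d 0 s"
    then show "u + a \<in> (\<Union>s. layer n d r s)" using layer_add[of u n d r _ a 0 s] by auto
  qed
  moreover have "?G \<subseteq> ?F"
    by (auto simp: monomial_in_fractions_iff irreducible_exponents_def)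
  ultimately show "submodule ?R hull ?G \<subseteq> ?F" by (intro hull_minimal)
next
  show "?F \<subseteq> submodule ?R hull ?G"
  proof
    fix x assume "x \<in> ?F"
    then obtain p :: "'k mpoly" where p: "Poly_Mapping.keys p \<subseteq> (\<Union>s. layer n d r s)"
      and x: "x = to_fract p / to_fract (monomial e)" by (auto simp: fractions_def)
    have "x = (\<Sum>a\<in>Poly_Mapping.keys p. to_fract (scalar (Poly_Mapping.lookup p a)) *
        (to_fract (monomial a) / to_fract (monomial e)))"
      unfolding x by (subst mpoly_as_sum[of p])
        (simp only: to_fract_sum to_fract_mult sum_divide_distrib times_divide_eq_right)
    also have "\<dots> \<in> submodule ?R hull ?G"
    proof (rule submodule_sum[OF submodule_hull])
      fix a assume "a \<in> Poly_Mapping.keys p"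
      then obtain s where "a \<in> layer n d r s" using p by blast
      then have "to_fract (monomial a) / to_fract (monomial e) \<in> submodule ?R hull ?G"
        by (rule fraction_generator_in_hull[OF assms])
      moreover have "scalar (Poly_Mapping.lookup p a) \<in> (squarefree_veronese n d :: 'k mpoly set)"
        using subalgebra_hull unfolding squarefree_veronese_def subalgebra_def by blast
      then have "to_fract (scalar (Poly_Mapping.lookup p a)) \<in> ?R" by (rule imageI)
      ultimately show "to_fract (scalar (Poly_Mapping.lookup p a)) *
          (to_fract (monomial a) / to_fract (monomial e)) \<in> submodule ?R hull ?G"
        using submodule_hull[of ?R ?G] unfolding submodule_def by blast
    qed
    finally show "x \<in> submodule ?R hull ?G" .
  qed
qed

lemma minimally_generates_irreducible:
  assumes "0 < r" "0 < d"
  shows "minimally_generates (to_fract ` (squarefree_veronese n d :: 'k::field mpoly set))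
      {to_fract (monomial a) / to_fract (monomial e) | a. a \<in> irreducible_exponents n d r}
      (fractions (\<Union>s. layer n d r s) e)"
    (is "minimally_generates ?R ?G ?F")
  unfolding minimally_generates_def
proof (intro conjI allI impI notI)
  show hull: "submodule ?R hull ?G = ?F" by (rule hull_irreducible[OF assms(1)])
  fix H assume H: "H \<subset> ?G" and eq: "submodule ?R hull H = ?F"
  then obtain u0 where u0: "u0 \<in> irreducible_exponents n d r"
    and notin: "to_fract (monomial u0) / to_fract (monomial e) \<notin> H" by blast
  \<comment> \<open>Removing u0 still leaves a submodule, as u0 = u + a forces a = 0. It contains H
    but not the omitted generator.\<close>
  let ?U = "(\<Union>s. layer n d r s) - {u0}"
  have "submodule ?R (fractions ?U e)"
  proof (rule submodule_fractions)
    fix u a t assume u: "u \<in> ?U" and a: "a \<in> layer n d 0 t"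
    then obtain s where s: "u \<in> layer n d r s" by blast
    have "u + a \<in> layer n d r (s + t)" using layer_add[OF s a] by simp
    moreover have "u + a \<noteq> u0"
    proof
      assume "u + a = u0"
      moreover from this have "a = 0" using irreducible_not_sum[OF _ s a assms(2)] u0 by simp
      ultimately show False using u by simp
    qed
    ultimately show "u + a \<in> ?U" by blast
  qed
  moreover have "H \<subseteq> fractions ?U e"
  proof
    fix x assume "x \<in> H"
    then obtain a where a: "a \<in> irreducible_exponents n d r"
      and x: "x = to_fract (monomial a) / to_fract (monomial e)" using H by blast
    have "a \<noteq> u0" using \<open>x \<in> H\<close> notin x by blast
    then show "x \<in> fractions ?U e"
      using a unfolding x monomial_in_fractions_iff irreducible_exponents_def by blast
  qed
  ultimately have "?F \<subseteq> fractions ?U e" unfolding eq[symmetric] by (intro hull_minimal)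
  moreover have "to_fract (monomial u0) / to_fract (monomial e) \<in> ?F"
    unfolding hull[symmetric] using u0 by (intro hull_inc) blast
  ultimately have "to_fract (monomial u0) / to_fract (monomial e) \<in> (fractions ?U e :: 'k mpoly fract set)"
    by (rule subsetD)
  then show False unfolding monomial_in_fractions_iff by simp
qed

section \<open>Comparison with squarefree monomials and \<open>P_vectors\<close>\<close>

lemma multiset_log_vector:
  "mset (log_vector n a) = image_mset (Poly_Mapping.lookup a) (mset_set {1..n})"
proof -
  have "mset [1..<n+1] = mset_set {1..n}"
    by (metis mset_upt atLeastLessThanSuc_atLeastAtMost Suc_eq_plus1)
  then show ?thesis by (simp add: log_vector_def del: mset_upt upt_Suc)
qed

text \<open>Up to permutation a vector is its multiset of entries. The trailing zeros of the pattern
  need no condition of their own: size and sum force them.\<close>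

lemma P_vectors_mset:
  assumes M: "size M = n" and n: "n > 2 * d"
  shows "(\<exists>v\<in>P_vectors n d. M = mset v) \<longleftrightarrow>
    (\<exists>c\<ge>2. d < count M c \<and> (\<forall>x\<in>#M. x \<le> c) \<and> sum_mset M = n - 2 * d + d * c)"
proof
  assume "\<exists>v\<in>P_vectors n d. M = mset v"
  then obtain c bs where c: "2 \<le> c" "c \<le> n - 2 * d" "sorted_wrt (\<ge>) (c # bs)" "sum_list bs = n - 2 * d - c"
    and Mv: "M = mset (replicate (d + 1) c @ bs @ replicate (d + c - 1) 0)"
    unfolding P_vectors_def by blast
  have "sum_mset M = (d + 1) * c + (n - 2 * d - c)"
    by (simp only: Mv sum_mset_sum_list sum_list_append sum_list_replicate c(4)) simp
  then have "sum_mset M = n - 2 * d + d * c" using c(2) by simp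
  moreover have "\<forall>x\<in>#M. x \<le> c" using c(3) by (auto simp: Mv)
  moreover have "d < count M c" by (simp add: Mv)
  ultimately show "\<exists>c\<ge>2. d < count M c \<and> (\<forall>x\<in>#M. x \<le> c) \<and> sum_mset M = n - 2 * d + d * c"
    using c(1) by blast
next
  assume "\<exists>c\<ge>2. d < count M c \<and> (\<forall>x\<in>#M. x \<le> c) \<and> sum_mset M = n - 2 * d + d * c"
  then obtain c where c: "2 \<le> c" "d < count M c" "\<forall>x\<in>#M. x \<le> c" "sum_mset M = n - 2 * d + d * c" by blast
  have "replicate_mset (d + 1) c \<subseteq># M" using c(2) by (subst count_le_replicate_mset_subset_eq[symmetric]) simp
  then obtain N where N: "M = replicate_mset (d + 1) c + N" by (auto simp: mset_subset_eq_exists_conv)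
  have sumN: "sum_mset N + c = n - 2 * d" using c(4) by (simp add: N)
  have sizeN: "size N + (d + 1) = n" using M by (simp add: N)
  \<comment> \<open>The n - d - 1 entries of N sum to n - 2d - c, so at most that many are nonzero,
    leaving at least d + c - 1 zeros.\<close>
  have "size (filter_mset (\<lambda>x. x \<noteq> 0) N) \<le> sum_mset N"
    by (induction N) auto
  moreover have "size N = size (filter_mset (\<lambda>x. x \<noteq> 0) N) + count N 0"
    by (induction N) auto
  ultimately have "d + c - 1 \<le> count N 0" using sumN sizeN n by linarith
  then have "replicate_mset (d + c - 1) 0 \<subseteq># N" by (subst count_le_replicate_mset_subset_eq[symmetric])
  then obtain Q where Q: "N = replicate_mset (d + c - 1) 0 + Q" by (auto simp: mset_subset_eq_exists_conv)
  define bs where "bs = rev (sorted_list_of_multiset Q)"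
  have Qbs: "mset bs = Q" by (simp add: bs_def)
  have "length bs = n - 2 * d - c"
  proof -
    have "length bs = size Q" using Qbs by (metis size_mset)
    then show ?thesis using sizeN c(1) n by (simp add: Q)
  qed
  moreover have "sum_list bs = n - 2 * d - c"
    using sumN Qbs by (simp add: Q flip: sum_mset_sum_list)
  moreover have "sorted_wrt (\<ge>) (c # bs)"
  proof -
    have "sorted (sorted_list_of_multiset Q)" by simp
    then have "sorted_wrt (\<ge>) bs" by (simp add: bs_def sorted_wrt_rev)
    moreover have "\<forall>x\<in>set bs. x \<le> c" using c(3) Qbs by (auto simp: N Q)
    ultimately show ?thesis by simp
  qed
  moreover have "c \<le> n - 2 * d" using sumN by simp
  ultimately have "replicate (d + 1) c @ bs @ replicate (d + c - 1) 0 \<in> P_vectors n d"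
    using c(1) unfolding P_vectors_def by blast
  moreover have "M = mset (replicate (d + 1) c @ bs @ replicate (d + c - 1) 0)"
    by (simp add: N Q Qbs)
  ultimately show "\<exists>v\<in>P_vectors n d. M = mset v" by blast
qed

lemma log_vector_P_vectors_iff:
  assumes "n > 2 * d" and a: "a \<in> exponents n"
  shows "(\<exists>v\<in>P_vectors n d. log_vector n a <~~> v) \<longleftrightarrow>
    (\<exists>c\<ge>2. a \<in> layer n d (n - 2 * d) c \<and> d < card {i \<in> {1..n}. Poly_Mapping.lookup a i = c})"
proof -
  let ?M = "mset (log_vector n a)"
  have "size ?M = n" by (simp add: log_vector_def)
  moreover have "count ?M c = card {i \<in> {1..n}. Poly_Mapping.lookup a i = c}" for c
  proof -
    have "{i \<in> {1..n}. Poly_Mapping.lookup a i = c} = Poly_Mapping.lookup a -` {c} \<inter> {1..n}" by auto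
    then show ?thesis
      unfolding multiset_log_vector count_image_mset by (simp add: count_mset_set')
  qed
  moreover have "(\<forall>x\<in>#?M. x \<le> c) \<longleftrightarrow> (\<forall>i\<in>{1..n}. Poly_Mapping.lookup a i \<le> c)" for c
    unfolding multiset_log_vector by auto
  moreover have "sum_mset ?M = (\<Sum>i=1..n. Poly_Mapping.lookup a i)"
    unfolding multiset_log_vector by (simp add: sum_unfold_sum_mset)
  ultimately show ?thesis
    using P_vectors_mset[of ?M n d] assms unfolding layer_def by auto
qed

text \<open>This is the case s = 1: the degree is n - d = (n - 2d) + d, and n > 2d makes the number
  n - d of ones exceed d.\<close>

lemma squarefree_iff_layer:
  assumes "2 * d < n" "a \<in> exponents n"
  shows "(\<exists>I. I \<subseteq> {1..n} \<and> card I = n - d \<and> (monomial a :: 'k::field mpoly) = (\<Prod>i\<in>I. var i)) \<longleftrightarrow>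
    a \<in> layer n d (n - 2 * d) 1 \<and> d < card {i \<in> {1..n}. Poly_Mapping.lookup a i = 1}" (is "?L \<longleftrightarrow> ?R")
proof
  assume ?L
  then obtain I where I: "I \<subseteq> {1..n}" "card I = n - d" "(monomial a :: 'k mpoly) = (\<Prod>i\<in>I. var i)" by blast
  have fin: "finite I" using I(1) finite_subset by blast
  have a: "a = squarefree_exponent I" using I(3) by (simp add: prod_var[OF fin] monomial_inject)
  have "{i \<in> {1..n}. Poly_Mapping.lookup a i = 1} = I"
    using I(1) by (auto simp: a lookup_squarefree_exponent[OF fin])
  moreover have "(\<Sum>i=1..n. Poly_Mapping.lookup a i) = n - 2 * d + d * 1"
    unfolding a sum_squarefree_exponent[OF I(1)] using I(2) assms(1) by simp
  moreover have "\<forall>i\<in>{1..n}. Poly_Mapping.lookup a i \<le> 1"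
    by (simp add: a lookup_squarefree_exponent[OF fin])
  ultimately show ?R using assms I(2) unfolding layer_def by simp
next
  assume R: ?R
  define I where "I = {i \<in> {1..n}. Poly_Mapping.lookup a i = 1}"
  have I: "I \<subseteq> {1..n}" "finite I" by (auto simp: I_def)
  have a: "a = squarefree_exponent I"
  proof (rule poly_mapping_eqI)
    fix i
    have "Poly_Mapping.lookup a i \<le> 1" if "i \<in> {1..n}" using R that unfolding layer_def by blast
    moreover have "Poly_Mapping.lookup a i = 0" if "i \<notin> {1..n}"
      using assms(2) that by (auto simp: exponents_def in_keys_iff)
    ultimately show "Poly_Mapping.lookup a i = Poly_Mapping.lookup (squarefree_exponent I) i"
      unfolding lookup_squarefree_exponent[OF I(2)] by (cases "i \<in> {1..n}") (auto simp: I_def)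
  qed
  have "card I = (\<Sum>i=1..n. Poly_Mapping.lookup a i)"
    unfolding a by (rule sum_squarefree_exponent[OF I(1), symmetric])
  also have "\<dots> = n - d" using R assms(1) by (simp add: layer_def)
  finally show ?L using I prod_var[OF I(2), where 'k='k] a by metis
qed

lemma irreducible_exponents_iff:
  assumes n: "2 * d < n"
  shows "a \<in> irreducible_exponents n d (n - 2 * d) \<longleftrightarrow> a \<in> exponents n \<and>
    ((\<exists>I. I \<subseteq> {1..n} \<and> card I = n - d \<and> (monomial a :: 'k::field mpoly) = (\<Prod>i\<in>I. var i)) \<or>
     (\<exists>v\<in>P_vectors n d. log_vector n a <~~> v))" (is "_ \<longleftrightarrow> _ \<and> (?L \<or> ?P)")
proof (cases "a \<in> exponents n")
  case True
  define Q where "Q s \<longleftrightarrow> a \<in> layer n d (n - 2 * d) s \<and>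
    d < card {i \<in> {1..n}. Poly_Mapping.lookup a i = s}" for s
  \<comment> \<open>The positive degree offset n - 2d excludes s = 0. Then s = 1 gives the
    squarefree monomials and s >= 2 the vectors with c = s.\<close>
  have "\<not> Q 0" using layer_0(2)[of a n d "n - 2 * d"] n by (auto simp: Q_def)
  then have "(\<exists>s. Q s) \<longleftrightarrow> Q 1 \<or> (\<exists>s\<ge>2. Q s)"
    by (metis One_nat_def Suc_leI le_neq_implies_less neq0_conv numeral_2_eq_2)
  then show ?thesis
    using True unfolding squarefree_iff_layer[OF n True] log_vector_P_vectors_iff[OF n True]
      irreducible_exponents_def Q_def by blast
next
  case False
  then show ?thesis by (auto simp: irreducible_exponents_def layer_def)
qed

theorem theorem4p12:
  fixes n d :: nat
  assumes "n > 2 * d" and "2 * d \<ge> 4"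
  shows "minimally_generates
    (to_fract ` (squarefree_veronese n d :: 'k::field mpoly set))
    {to_fract (monomial a) / to_fract (\<Prod>i=1..n. var i) | a. a \<in> exponents n \<and>
       ((\<exists>I. I \<subseteq> {1..n} \<and> card I = n - d \<and> (monomial a :: 'k mpoly) = (\<Prod>i\<in>I. var i)) \<or>
        (\<exists>v \<in> P_vectors n d. log_vector n a <~~> v))}
    (anticanonical_ideal n d)"
proof -
  have "2 * d < n" "2 \<le> d" "0 < n - 2 * d" "0 < d" using assms by auto
  then show ?thesis
    unfolding irreducible_exponents_iff[OF \<open>2 * d < n\<close>, where 'k='k, symmetric]
      anticanonical_ideal_eq[OF \<open>2 * d < n\<close> \<open>2 \<le> d\<close>] prod_var[OF finite_atLeastAtMost]
    by (intro minimally_generates_irreducible)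
qed

end
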